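(* Let $N\ge 3$ be an odd integer. Let $\{\nu_j\}_{j=1}^{(N-3)/2}$ be the set of positive roots of the equation $U'_{N-2}(x)=0$, let $\gamma_j=1-2\nu_j^2$ for $j=1,\ldots,(N-3)/2$, and let \[ p(z)=1+\frac{N}{N-2}(z+z^{N-1})+z^N . \] Then \[ p(z)=(1+z)^3\prod_{j=1}^{(N-3)/2}\left[1+z^2-2z\gamma_j\right]. \]
   Context: $U_j$ denotes the Chebyshev polynomial of the second kind of degree $j$, defined by $U_j(\cos t)=\frac{\sin (j+1)t}{\sin t}$, so that $U_j(x)=2^jx^j+\ldots$; $U'_j$ denotes its derivative. Empty products equal $1$. *)

theory Defs
  imports Complex_Main "HOL-Computational_Algebra.Polynomial"
begin

definition chebyshev_U :: "nat \<Rightarrow> real poly" where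
  "chebyshev_U j =
     (THE q. \<forall>t::real. sin t \<noteq> 0 \<longrightarrow> poly q (cos t) = sin (real (j + 1) * t) / sin t)"

text \<open>The description is proper: the polynomial exists, by the three-term recurrence, and it is
  unique, since the values of cosine at points where sine does not vanish fill \<open>{-1<..<1}\<close>.\<close>

fun chebyshev_U_rec :: "nat \<Rightarrow> real poly" where
  "chebyshev_U_rec 0 = 1"
| "chebyshev_U_rec (Suc 0) = [:0, 2:]"
| "chebyshev_U_rec (Suc (Suc j)) = [:0, 2:] * chebyshev_U_rec (Suc j) - chebyshev_U_rec j"

lemma poly_chebyshev_U_rec_cos: "poly (chebyshev_U_rec j) (cos t) * sin t = sin (real (j + 1) * t)"
proof (induction j rule: chebyshev_U_rec.induct)
  case 1
  show ?case by simp
next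
  case 2
  show ?case by (simp add: sin_double)
next
  case (3 j)
  have "sin (real (j + 3) * t) + sin (real (j + 1) * t) = 2 * cos t * sin (real (j + 2) * t)"
    using sin_add[of "real (j + 2) * t" t] sin_diff[of "real (j + 2) * t" t]
    by (simp add: algebra_simps)
  then show ?case
    using 3 by (simp add: algebra_simps)
qed

lemma chebyshev_U_eqI:
  assumes "\<forall>t::real. sin t \<noteq> 0 \<longrightarrow> poly q (cos t) = sin (real (j + 1) * t) / sin t"
  shows "q = chebyshev_U_rec j"
proof (rule ccontr)
  assume "q \<noteq> chebyshev_U_rec j"
  then have "finite {x. poly (q - chebyshev_U_rec j) x = 0}"
    by (intro poly_roots_finite) simp
  moreover have "{-1<..<1} \<subseteq> {x. poly (q - chebyshev_U_rec j) x = 0}"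
  proof
    fix x :: real assume x: "x \<in> {-1<..<1}"
    define t where "t = arccos x"
    have t: "cos t = x" "sin t \<noteq> 0"
      using x by (auto simp: t_def sin_arccos_nonzero)
    have "poly q x * sin t = poly (chebyshev_U_rec j) x * sin t"
      using assms[rule_format, OF t(2)] t poly_chebyshev_U_rec_cos[of j t] by simp
    then show "x \<in> {x. poly (q - chebyshev_U_rec j) x = 0}"
      using t by simp
  qed
  ultimately have "finite {-1<..<1::real}"
    by (rule rev_finite_subset)
  then show False
    using infinite_Ioo[of "-1" "1::real"] by simp
qed

lemma chebyshev_U_eq_rec: "chebyshev_U j = chebyshev_U_rec j"
  unfolding chebyshev_U_def
proof (rule the_equality)
  show "\<forall>t::real. sin t \<noteq> 0 \<longrightarrow>
      poly (chebyshev_U_rec j) (cos t) = sin (real (j + 1) * t) / sin t"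
    using poly_chebyshev_U_rec_cos[of j] by (auto simp: field_simps)
qed (rule chebyshev_U_eqI)

lemma poly_chebyshev_U_cos:
  assumes "sin t \<noteq> 0"
  shows "poly (chebyshev_U j) (cos t) = sin (real (j + 1) * t) / sin t"
  using poly_chebyshev_U_rec_cos[of j t] assms by (simp add: chebyshev_U_eq_rec field_simps)

end

(* On the unit circle put z = -cis (2 s).  Differentiating U_n (cos s) * sin s = sin ((n + 1) s) for
   n = N - 2 turns (N - 2) * p z into 4 * i * cis (N s) * (sin s)^3 * U_n' (cos s), while the right-hand
   side becomes 8 * i * cis (N s) * (sin s)^3 * (\<Prod>j. 4 * ((cos s)^2 - (\<nu> j)^2)).  The two agree
   because U_n' is an even polynomial of degree N - 3 all of whose roots are real and simple: Rolle's
   theorem between the zeros cos (j \<pi> / (N - 1)) of U_n yields (N - 3) / 2 positive ones.  Two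
   polynomials in z that agree on the circle are equal. *)
theory Submission imports Defs begin

section \<open>Degree, leading coefficient, parity and derivative of the Chebyshev
  polynomials\<close>

lemma degree_chebyshev_U_rec: "degree (chebyshev_U_rec j) \<le> j"
proof (induction j rule: chebyshev_U_rec.induct)
  case (3 j)
  have "degree ([:0, 2:] * chebyshev_U_rec (Suc j)) \<le> Suc (Suc j)"
    using degree_mult_le[of "[:0, 2:]" "chebyshev_U_rec (Suc j)"] 3 by simp
  then show ?case
    using 3 by (auto intro!: degree_diff_le)
qed auto

lemma coeff_chebyshev_U_rec: "coeff (chebyshev_U_rec j) j = 2 ^ j"
proof (induction j rule: chebyshev_U_rec.induct)
  case (3 j)
  have "coeff (chebyshev_U_rec j) (Suc (Suc j)) = 0"
    using degree_chebyshev_U_rec[of j] by (intro coeff_eq_0) simp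
  then show ?case
    using 3 by simp
qed auto

lemma chebyshev_U_rec_reflect:
  "pcompose (chebyshev_U_rec j) [:0, -1:] = smult ((- 1) ^ j) (chebyshev_U_rec j)"
proof (induction j rule: chebyshev_U_rec.induct)
  case (3 j)
  then show ?case
    by (simp add: pcompose_diff pcompose_smult pcompose_pCons smult_diff_right mult.commute)
qed (auto simp: pcompose_1 pcompose_pCons)

text \<open>For odd \<open>n\<close> the polynomial is odd by the reflection rule, and the chain
  rule for the substitution of \<open>- x\<close> turns this into evenness of the
  derivative.\<close>

lemma poly_pderiv_chebyshev_U_rec_minus:
  assumes "odd n"
  shows "poly (pderiv (chebyshev_U_rec n)) (- x) = poly (pderiv (chebyshev_U_rec n)) x"
proof -
  have "pderiv (pcompose (chebyshev_U_rec n) [:0, -1:]) = - pderiv (chebyshev_U_rec n)"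
    using assms by (simp add: chebyshev_U_rec_reflect pderiv_minus)
  then have "poly (pcompose (pderiv (chebyshev_U_rec n)) [:0, -1:] * pderiv [:0, -1:]) x
      = - poly (pderiv (chebyshev_U_rec n)) x"
    by (simp only: pderiv_pcompose poly_minus)
  then show ?thesis
    by (simp add: poly_pcompose pderiv_pCons)
qed

text \<open>Both sides of \<open>poly_chebyshev_U_rec_cos\<close> are differentiated in
  \<open>t\<close>. A further factor \<open>sin t\<close> eliminates the remaining value of the
  polynomial; nothing is divided, so points with \<open>sin t = 0\<close> are covered.\<close>

lemma poly_pderiv_chebyshev_U_rec_cos:
  "poly (pderiv (chebyshev_U_rec n)) (cos t) * sin t ^ 3
    = sin (real (n + 1) * t) * cos t - real (n + 1) * cos (real (n + 1) * t) * sin t"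
proof -
  have "((\<lambda>t. poly (chebyshev_U_rec n) (cos t) * sin t) has_real_derivative
      poly (pderiv (chebyshev_U_rec n)) (cos t) * (- sin t) * sin t
        + poly (chebyshev_U_rec n) (cos t) * cos t) (at t)"
    by (auto intro!: derivative_eq_intros DERIV_chain2[OF poly_DERIV])
  moreover have "((\<lambda>t. poly (chebyshev_U_rec n) (cos t) * sin t) has_real_derivative
      real (n + 1) * cos (real (n + 1) * t)) (at t)"
    unfolding poly_chebyshev_U_rec_cos by (auto intro!: derivative_eq_intros)
  ultimately have "poly (pderiv (chebyshev_U_rec n)) (cos t) * (- sin t) * sin t
      + poly (chebyshev_U_rec n) (cos t) * cos t = real (n + 1) * cos (real (n + 1) * t)"
    by (rule DERIV_unique)
  then show ?thesis
    using poly_chebyshev_U_rec_cos[of n t] by algebra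
qed

section \<open>Positive roots of the derivative and its factorization\<close>

text \<open>The polynomial has \<open>k + 1\<close> nonnegative zeros, hence \<open>k\<close> gaps
  between them, and Rolle's theorem puts a critical point into each. Finiteness is assumed since
  \<open>card\<close> of an infinite set is 0.\<close>

lemma card_pos_roots_pderiv_chebyshev_U_rec:
  assumes "finite {x. x > 0 \<and> poly (pderiv (chebyshev_U_rec (2 * k + 1))) x = 0}"
  shows "k \<le> card {x. x > 0 \<and> poly (pderiv (chebyshev_U_rec (2 * k + 1))) x = 0}"
proof -
  let ?U = "chebyshev_U_rec (2 * k + 1)"
  let ?S = "{x. x > 0 \<and> poly (pderiv ?U) x = 0}"
  define \<theta> where "\<theta> j = real j * pi / real (2 * k + 2)" for j
  have \<theta>_le: "\<theta> i \<le> \<theta> j" if "i \<le> j" for i j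
    using that by (auto simp: \<theta>_def intro!: divide_right_mono mult_right_mono)
  \<comment> \<open>The smallest zero considered is \<open>cos (pi / 2) = 0\<close>; every critical
    point found above it is therefore positive.\<close>
  have \<theta>_half: "\<theta> (k + 1) = pi / 2"
    by (simp add: \<theta>_def field_simps)
  have root: "poly ?U (cos (\<theta> j)) = 0" if "j \<in> {1..k + 1}" for j
  proof -
    have "\<theta> j > 0"
      using that by (simp add: \<theta>_def)
    moreover have "\<theta> j < pi"
      using \<theta>_le[of j "k + 1"] \<theta>_half that pi_gt_zero
      unfolding atLeastAtMost_iff by linarith
    ultimately have "sin (\<theta> j) \<noteq> 0"
      using sin_gt_zero by force
    moreover have "sin (real (2 * k + 1 + 1) * \<theta> j) = 0"
      by (simp add: \<theta>_def sin_npi)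
    ultimately show ?thesis
      using poly_chebyshev_U_rec_cos[of "2 * k + 1" "\<theta> j"] by simp
  qed
  have "\<exists>x. cos (\<theta> (j + 1)) < x \<and> x < cos (\<theta> j) \<and> poly (pderiv ?U) x = 0"
    if "j \<in> {1..k}" for j
  proof -
    have "\<theta> j < \<theta> (j + 1)"
      by (simp add: \<theta>_def divide_strict_right_mono)
    moreover have "\<theta> (j + 1) \<le> pi"
      using \<theta>_le[of "j + 1" "k + 1"] \<theta>_half that pi_gt_zero
      unfolding atLeastAtMost_iff by linarith
    moreover have "\<theta> j \<ge> 0"
      by (simp add: \<theta>_def)
    ultimately have less: "cos (\<theta> (j + 1)) < cos (\<theta> j)"
      by (intro cos_monotone_0_pi)
    then show ?thesis
      using poly_MVT[OF less, of ?U] root[of j] root[of "j + 1"] that by auto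
  qed
  then obtain r where r: "\<And>j. j \<in> {1..k} \<Longrightarrow> cos (\<theta> (j + 1)) < r j"
    "\<And>j. j \<in> {1..k} \<Longrightarrow> r j < cos (\<theta> j)" "\<And>j. j \<in> {1..k} \<Longrightarrow> poly (pderiv ?U) (r j) = 0"
    by metis
  have cos_le: "cos (\<theta> j) \<le> cos (\<theta> i)" if "i \<le> j" "j \<le> k + 1" for i j
  proof (rule cos_monotone_0_pi_le)
    show "0 \<le> \<theta> i" by (simp add: \<theta>_def)
    show "\<theta> j \<le> pi" using \<theta>_le[OF that(2)] \<theta>_half pi_gt_zero by linarith
  qed (rule \<theta>_le[OF that(1)])
  \<comment> \<open>The gaps are disjoint and move left as the index grows, because cosine decreases
    on \<open>[0, pi]\<close>.\<close>
  have decreasing: "r j < r i" if "i < j" "i \<in> {1..k}" "j \<in> {1..k}" for i j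
    using r(1)[OF that(2)] r(2)[OF that(3)] cos_le[of "i + 1" j] that by simp
  have "inj_on r {1..k}"
    by (intro linorder_inj_onI) (use decreasing in force)+
  moreover have "r ` {1..k} \<subseteq> ?S"
  proof -
    have "r j > 0" if "j \<in> {1..k}" for j
      using r(1)[OF that] cos_le[of "j + 1" "k + 1"] that unfolding \<theta>_half by simp
    then show ?thesis
      using r(3) by auto
  qed
  ultimately show ?thesis
    using card_inj_on_le[of r "{1..k}" ?S] assms by simp
qed

text \<open>Both sides have degree at most \<open>2 * k\<close> and the same coefficient there, so
  agreement at \<open>2 * k\<close> points suffices. The positive roots and their negatives supply
  these points.\<close>

lemma poly_pderiv_chebyshev_U_rec_eq_prod:
  assumes "\<nu> ` {1..k} = {x. x > 0 \<and> poly (pderiv (chebyshev_U_rec (2 * k + 1))) x = 0}"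
  shows "poly (pderiv (chebyshev_U_rec (2 * k + 1))) x
    = real (2 * k + 1) * 2 ^ (2 * k + 1) * (\<Prod>j=1..k. x\<^sup>2 - (\<nu> j)\<^sup>2)"
proof -
  let ?D = "pderiv (chebyshev_U_rec (2 * k + 1))"
  let ?S = "{x. x > 0 \<and> poly ?D x = 0}"
  \<comment> \<open>The leading coefficient \<open>2 ^ (2 * k + 1)\<close> times the exponent that
    differentiation brings down.\<close>
  define c where "c = real (2 * k + 1) * 2 ^ (2 * k + 1)"
  define Q where "Q = (\<Prod>j=1..k. [:- (\<nu> j)\<^sup>2, 0, 1:])"
  have fin: "finite ?S"
    using assms by (metis finite_atLeastAtMost finite_imageI)
  have card: "k \<le> card ?S"
    using fin by (rule card_pos_roots_pderiv_chebyshev_U_rec)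
  have poly_Q: "poly Q x = (\<Prod>j=1..k. x\<^sup>2 - (\<nu> j)\<^sup>2)" for x
    by (simp add: Q_def poly_prod power2_eq_square algebra_simps)
  have deg_Q: "degree Q = 2 * k"
    unfolding Q_def by (subst degree_prod_sum_eq) auto
  have "lead_coeff Q = 1"
    unfolding Q_def lead_coeff_prod by simp
  have "card (?S \<union> uminus ` ?S) = 2 * card ?S"
    using fin by (subst card_Un_disjoint) (auto simp: card_image)
  have "?D = smult c Q"
  proof (rule poly_eqI_degree_lead_coeff[where n = "2 * k" and A = "?S \<union> uminus ` ?S"])
    show "coeff ?D (2 * k) = coeff (smult c Q) (2 * k)"
      using \<open>lead_coeff Q = 1\<close> coeff_chebyshev_U_rec[of "2 * k + 1"]
      by (simp add: coeff_pderiv deg_Q c_def del: chebyshev_U_rec.simps)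
    show "2 * k \<le> card (?S \<union> uminus ` ?S)"
      using card \<open>card (?S \<union> uminus ` ?S) = 2 * card ?S\<close> by simp
    show "degree ?D \<le> 2 * k"
      using degree_chebyshev_U_rec[of "2 * k + 1"] by (simp add: degree_pderiv)
    show "degree (smult c Q) \<le> 2 * k"
      using degree_smult_le[of c Q] deg_Q by simp
    fix y assume "y \<in> ?S \<union> uminus ` ?S"
    then obtain x where x: "x \<in> ?S" "y = x \<or> y = - x"
      by blast
    then have "poly ?D y = 0"
      using poly_pderiv_chebyshev_U_rec_minus[of "2 * k + 1" x] by auto
    moreover obtain j where "j \<in> {1..k}" "\<nu> j = x"
      using x(1) assms by (metis (no_types, lifting) imageE)
    then have "poly Q y = 0"
      using x(2) unfolding poly_Q by (auto intro!: prod_zero)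
    ultimately show "poly ?D y = poly (smult c Q) y"
      by simp
  qed
  then show ?thesis
    by (simp add: poly_Q c_def)
qed

section \<open>Both sides of the identity on the unit circle\<close>

lemma cis_minus_cis_minus: "cis a - cis (- a) = 2 * \<i> * of_real (sin a)"
  by (simp add: complex_eq_iff)

lemma one_minus_cis_double: "1 - cis (2 * a) = - 2 * \<i> * of_real (sin a) * cis a"
proof -
  have "1 - cis (2 * a) = - (cis a - cis (- a)) * cis a"
    by (simp add: left_diff_distrib cis_mult)
  then show ?thesis
    by (simp add: cis_minus_cis_minus)
qed

text \<open>The exponents in each of the pairs \<open>1\<close>, \<open>z ^ (2 * k + 3)\<close> and
  \<open>z\<close>, \<open>z ^ (2 * k + 2)\<close> have the same mean. Factoring out the common
  \<open>cis (a + s)\<close> leaves one sine per pair.\<close>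

lemma trinomial_on_circle:
  fixes k :: nat and s :: real
  defines "z \<equiv> - cis (2 * s)"
  shows "(2 * of_nat k + 1) * (1 + z ^ (2 * k + 3)) + (2 * of_nat k + 3) * (z + z ^ (2 * k + 2))
    = 4 * \<i> * cis (real (2 * k + 3) * s) *
        of_real (poly (pderiv (chebyshev_U_rec (2 * k + 1))) (cos s) * sin s ^ 3)"
proof -
  define a where "a = real (2 * k + 2) * s"
  have odd_power: "1 + z ^ (2 * k + 3) = - 2 * \<i> * of_real (sin (a + s)) * cis (a + s)"
  proof -
    have "z ^ (2 * k + 3) = - cis (2 * (a + s))"
      by (simp add: z_def power_minus' Complex.DeMoivre a_def algebra_simps del: power_Suc)
    then show ?thesis
      using one_minus_cis_double[of "a + s"] by simp
  qed
  have even_power: "z + z ^ (2 * k + 2) = 2 * \<i> * of_real (sin (a - s)) * cis (a + s)"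
  proof -
    have "z ^ (2 * k + 2) = cis (2 * a)"
      by (simp add: z_def Complex.DeMoivre a_def algebra_simps del: power_Suc)
    moreover have "(cis (a - s) - cis (- (a - s))) * cis (a + s) = cis (2 * a) - cis (2 * s)"
      by (simp add: left_diff_distrib cis_mult)
    ultimately show ?thesis
      unfolding cis_minus_cis_minus by (simp add: z_def del: power_Suc)
  qed
  \<comment> \<open>The product-to-sum formulas turn the derivative formula into a combination of
    the same two sines.\<close>
  have D: "2 * (poly (pderiv (chebyshev_U_rec (2 * k + 1))) (cos s) * sin s ^ 3)
      = (2 * real k + 3) * sin (a - s) - (2 * real k + 1) * sin (a + s)"
  proof -
    have "2 * (poly (pderiv (chebyshev_U_rec (2 * k + 1))) (cos s) * sin s ^ 3)
        = 2 * (sin a * cos s - (2 * real k + 2) * cos a * sin s)"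
      using poly_pderiv_chebyshev_U_rec_cos[of "2 * k + 1" s]
      by (simp add: a_def del: chebyshev_U_rec.simps)
    then show ?thesis
      by (simp add: sin_add sin_diff algebra_simps)
  qed
  have "real (2 * k + 3) * s = a + s"
    by (simp add: a_def algebra_simps)
  have "(2 * of_nat k + 1) * (1 + z ^ (2 * k + 3)) + (2 * of_nat k + 3) * (z + z ^ (2 * k + 2))
      = 2 * \<i> * cis (a + s) *
          of_real ((2 * real k + 3) * sin (a - s) - (2 * real k + 1) * sin (a + s))"
    unfolding odd_power even_power by (simp add: algebra_simps)
  also have "\<dots> = 4 * \<i> * cis (a + s) *
        of_real (poly (pderiv (chebyshev_U_rec (2 * k + 1))) (cos s) * sin s ^ 3)"
    unfolding D[symmetric] of_real_mult[of 2] by simp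
  finally show ?thesis
    unfolding \<open>real (2 * k + 3) * s = a + s\<close> .
qed

text \<open>Since \<open>z + 1 / z = - 2 * cos (2 * s)\<close> on the circle, taking
  \<open>z\<close> out of the quadratic leaves a real factor, and the double-angle formula makes it
  a difference of squares.\<close>

lemma quadratic_on_circle:
  fixes s x :: real
  defines "z \<equiv> - cis (2 * s)"
  shows "1 + z\<^sup>2 - 2 * z * of_real (1 - 2 * x\<^sup>2) = 4 * cis (2 * s) * of_real ((cos s)\<^sup>2 - x\<^sup>2)"
proof -
  have "1 + z\<^sup>2 = cis (2 * s) * (cis (2 * s) + cis (- (2 * s)))"
    by (simp add: z_def distrib_left cis_mult Complex.DeMoivre)
  also have "cis (2 * s) + cis (- (2 * s)) = of_real (2 * cos (2 * s))"
    by (simp add: complex_eq_iff)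
  also have "cos (2 * s) = 2 * (cos s)\<^sup>2 - 1"
    by (rule cos_double_cos)
  finally show ?thesis
    by (simp add: z_def algebra_simps)
qed

text \<open>The cube contributes the phase \<open>3 * s\<close> and each of the \<open>k\<close>
  quadratics \<open>2 * s\<close>, which add up to the phase of the trinomial.\<close>

lemma cube_times_quadratics_on_circle:
  fixes s :: real
  defines "z \<equiv> - cis (2 * s)"
  shows "(1 + z) ^ 3 * (\<Prod>j=1..k. 1 + z\<^sup>2 - 2 * z * of_real (1 - 2 * (\<nu> j)\<^sup>2))
    = 8 * \<i> * cis (real (2 * k + 3) * s) *
        of_real (sin s ^ 3 * 4 ^ k * (\<Prod>j=1..k. (cos s)\<^sup>2 - (\<nu> j)\<^sup>2))"
proof -
  have "(1 + z) ^ 3 = 8 * \<i> * of_real (sin s ^ 3) * cis (3 * s)"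
    using one_minus_cis_double[of s]
    by (simp add: z_def power_mult_distrib Complex.DeMoivre power3_eq_cube[of \<i>])
  moreover have "(\<Prod>j=1..k. 1 + z\<^sup>2 - 2 * z * of_real (1 - 2 * (\<nu> j)\<^sup>2))
      = cis (real (2 * k) * s) * of_real (4 ^ k * (\<Prod>j=1..k. (cos s)\<^sup>2 - (\<nu> j)\<^sup>2))"
    unfolding z_def quadratic_on_circle
    by (simp add: prod.distrib power_mult_distrib Complex.DeMoivre mult_ac
        del: of_real_diff)
  moreover have "cis (real (2 * k + 3) * s) = cis (3 * s) * cis (real (2 * k) * s)"
    by (simp add: cis_mult algebra_simps)
  ultimately show ?thesis
    by (simp only: of_real_mult mult_ac)
qed

section \<open>From the circle to all complex numbers\<close>

lemma poly_eq_if_eq_on_circle: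
  fixes P Q :: "complex poly"
  assumes "\<And>s :: real. poly P (- cis (2 * s)) = poly Q (- cis (2 * s))"
  shows "P = Q"
proof (rule ccontr)
  assume "P \<noteq> Q"
  then have "finite {z. poly (P - Q) z = 0}"
    by (intro poly_roots_finite) simp
  \<comment> \<open>For these \<open>s\<close> the angle \<open>2 * s\<close> stays in the range
    where cosine is injective, so infinitely many points of the circle are hit.\<close>
  moreover have "(\<lambda>s. - cis (2 * s)) ` {0<..<pi / 2} \<subseteq> {z. poly (P - Q) z = 0}"
    using assms by auto
  ultimately have "finite ((\<lambda>s. - cis (2 * s)) ` {0<..<pi / 2})"
    by (rule rev_finite_subset)
  moreover have "inj_on (\<lambda>s. - cis (2 * s)) {0<..<pi / 2}"
  proof (rule inj_onI)
    fix s t assume "s \<in> {0<..<pi / 2}" "t \<in> {0<..<pi / 2}" "- cis (2 * s) = - cis (2 * t)"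
    then show "s = t"
      using cos_inj_pi[of "2 * s" "2 * t"] by (simp add: complex_eq_iff)
  qed
  ultimately have "finite {0<..<pi / 2}"
    by (rule finite_imageD)
  then show False
    by (simp add: infinite_Ioo)
qed

theorem theorem6:
  fixes N :: nat and \<nu> \<gamma> :: "nat \<Rightarrow> real" and p :: "complex \<Rightarrow> complex"
  assumes "N \<ge> 3" and "odd N"
    and "\<nu> ` {1..(N - 3) div 2} = {x. x > 0 \<and> poly (pderiv (chebyshev_U (N - 2))) x = 0}"
    and "\<And>j. j \<in> {1..(N - 3) div 2} \<Longrightarrow> \<gamma> j = 1 - 2 * (\<nu> j)\<^sup>2"
    and "\<And>z. p z = 1 + of_nat N / (of_nat N - 2) * (z + z ^ (N - 1)) + z ^ N"
  shows "p z = (1 + z) ^ 3 * (\<Prod>j=1..(N - 3) div 2. (1 + z\<^sup>2 - 2 * z * of_real (\<gamma> j)))"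
proof -
  define k where "k = (N - 3) div 2"
  have N: "N = 2 * k + 3"
    using assms(1,2) by (auto simp: k_def elim!: oddE)
  have \<nu>: "\<nu> ` {1..k} = {x. x > 0 \<and> poly (pderiv (chebyshev_U_rec (2 * k + 1))) x = 0}"
    using assms(3) by (simp add: N chebyshev_U_eq_rec)
  \<comment> \<open>This is \<open>N - 2\<close>, so \<open>c + 2\<close> is \<open>N\<close>;
    multiplying by \<open>c\<close> clears the denominator of \<open>p\<close>.\<close>
  define c :: complex where "c = 2 * of_nat k + 1"
  have "c \<noteq> 0"
    unfolding c_def by (metis of_nat_0_eq_iff of_nat_1 of_nat_add of_nat_mult of_nat_numeral
        add_is_0 one_neq_zero)
  define P :: "complex poly" where
    "P = 1 + smult ((c + 2) / c) (monom 1 1 + monom 1 (2 * k + 2)) + monom 1 (2 * k + 3)"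
  define Q :: "complex poly" where
    "Q = [:1, 1:] ^ 3 * (\<Prod>j=1..k. [:1, - 2 * of_real (1 - 2 * (\<nu> j)\<^sup>2), 1:])"
  have poly_P: "poly P z = 1 + (c + 2) / c * (z + z ^ (2 * k + 2)) + z ^ (2 * k + 3)" for z
    by (simp add: P_def poly_monom del: power_Suc)
  have poly_Q: "poly Q z = (1 + z) ^ 3 * (\<Prod>j=1..k. 1 + z\<^sup>2 - 2 * z * of_real (1 - 2 * (\<nu> j)\<^sup>2))"
    for z
    by (simp add: Q_def poly_prod power2_eq_square algebra_simps)
  have "P = Q"
  proof (rule poly_eq_if_eq_on_circle)
    fix s :: real
    let ?z = "- cis (2 * s)"
    have "c * poly P ?z = c * (1 + ?z ^ (2 * k + 3)) + (c + 2) * (?z + ?z ^ (2 * k + 2))"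
      using \<open>c \<noteq> 0\<close> unfolding poly_P by (simp add: field_simps del: power_Suc)
    also have "\<dots> = 4 * \<i> * cis (real (2 * k + 3) * s) *
        of_real (poly (pderiv (chebyshev_U_rec (2 * k + 1))) (cos s) * sin s ^ 3)"
      using trinomial_on_circle[of k s] by (simp add: c_def algebra_simps del: power_Suc)
    \<comment> \<open>The constants match because
      \<open>4 * 2 ^ (2 * k + 1) = 8 * 4 ^ k\<close>.\<close>
    also have "\<dots> = c * poly Q ?z"
      unfolding poly_pderiv_chebyshev_U_rec_eq_prod[OF \<nu>] poly_Q cube_times_quadratics_on_circle
      by (simp add: c_def power_mult)
    finally show "poly P ?z = poly Q ?z"
      using \<open>c \<noteq> 0\<close> by simp
  qed
  then have "poly P z = poly Q z"
    by simp
  moreover have "p z = poly P z"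
    unfolding poly_P assms(5) by (simp add: N c_def add.commute)
  moreover have "poly Q z = (1 + z) ^ 3 * (\<Prod>j=1..(N - 3) div 2. (1 + z\<^sup>2 - 2 * z * of_real (\<gamma> j)))"
    unfolding poly_Q k_def using assms(4) by simp
  ultimately show ?thesis
    by simp
qed

end
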